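(* Let $\theta>0$, let $A_i,\alpha_i>0$ for $i=1,\dots,p$ and $B_j,\beta_j>0$ for $j=1,\dots,s$. Suppose that $$\sum_{i=1}^p\alpha_iA_i=\sum_{j=1}^s\beta_jB_j,\qquad \prod_{i=1}^pA_i^{\alpha_iA_i}\prod_{j=1}^sB_j^{-\beta_jB_j}\le\theta,$$ that $a\ge1/2$, and moreover that (a) $A_1\ge A_2\ge\dots\ge A_p\ge B_1\ge B_2\ge\dots\ge B_s>0$; (b) $\alpha_1A_1\ge\alpha_2A_2\ge\dots\ge\alpha_pA_p>0$; (c) $0<\beta_1B_1\le\beta_2B_2\le\dots\le\beta_sB_s$. Then the function $$V(x)=\theta^{-x}\frac{\prod_{i=1}^p\Gamma(A_ix+a)^{\alpha_i}}{\prod_{j=1}^s\Gamma(B_jx+a)^{\beta_j}},\qquad x>0,$$ is logarithmically completely monotonic.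
   Context: $\Gamma$ is Euler's gamma function. A function $f:(0,\infty)\to\mathbb R$ is completely monotonic if it is infinitely differentiable, $f\ge0$, and $(-1)^nf^{(n)}(x)\ge0$ for all $n\ge1$, $x>0$. A positive function $f$ on $(0,\infty)$ is logarithmically completely monotonic if $-(\log f)'$ is completely monotonic. *)

theory Defs
  imports "HOL-Analysis.Analysis"
begin

text \<open>
  Functions on the positive half-line are represented by total functions on the reals; only their
  values there matter, since the half-line is open and \<^const>\<open>deriv\<close> is local.
\<close>

definition completely_monotonic :: "(real \<Rightarrow> real) \<Rightarrow> bool" where
  "completely_monotonic f \<longleftrightarrow>
     (\<forall>n. \<forall>x>0. (deriv ^^ n) f differentiable (at x)) \<and>
     (\<forall>x>0. 0 \<le> f x) \<and>
     (\<forall>n\<ge>1. \<forall>x>0. 0 \<le> (-1) ^ n * (deriv ^^ n) f x)"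

text \<open>
  Differentiability of the logarithm has to be required explicitly, because \<^const>\<open>deriv\<close> has an
  unspecified value where the derivative does not exist.
\<close>

definition log_completely_monotonic :: "(real \<Rightarrow> real) \<Rightarrow> bool" where
  "log_completely_monotonic f \<longleftrightarrow>
     (\<forall>x>0. 0 < f x) \<and>
     (\<forall>x>0. (\<lambda>y. ln (f y)) differentiable (at x)) \<and>
     completely_monotonic (\<lambda>x. - deriv (\<lambda>y. ln (f y)) x)"

end

theory Submission
  imports Defs "HOL-Real_Asymp.Real_Asymp"
begin

text \<open>
  Write \<open>\<psi>\<close> for the digamma function. The negative logarithmic derivative of the quotient in
  question is
  \[ f(x) = \ln\theta - \sum_i \alpha_i A_i \psi(A_i x + a) + \sum_j \beta_j B_j \psi(B_j x + a), \]
  so all its derivatives are combinations of polygamma functions with the same weights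
  \<open>w\<^sub>i = \<alpha>\<^sub>i A\<^sub>i\<close> and \<open>v\<^sub>j = \<beta>\<^sub>j B\<^sub>j\<close>, whose totals agree. Since every \<open>A\<^sub>i\<close> dominates every \<open>B\<^sub>j\<close>,
  any nondecreasing function \<open>g\<close> satisfies \<open>\<Sum>\<^sub>j v\<^sub>j g(B\<^sub>j) \<le> \<Sum>\<^sub>i w\<^sub>i g(A\<^sub>i)\<close>
  (\<open>weighted_sum_le_of_separated\<close>). Both sign conditions are instances of this:

  \<^item> for \<open>n \<ge> 1\<close>, \<open>(-1)\<^sup>n f\<^sup>(\<^sup>n\<^sup>)(x)\<close> is the difference of the two sides for
    \<open>g(c) = c\<^sup>n \<bar>\<psi>\<^sup>(\<^sup>n\<^sup>)(c x + a)\<bar>\<close>, so it suffices that \<open>z\<^sup>n \<bar>\<psi>\<^sup>(\<^sup>n\<^sup>)(z + a)\<bar>\<close> increases in \<open>z\<close>;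

  \<^item> for \<open>n = 0\<close>, take \<open>g(c) = ln(c x) - \<psi>(c x + a)\<close>, which is increasing in \<open>c\<close>. The terms
    \<open>ln x\<close> cancel by equality of the total weights, and the terms \<open>ln A\<^sub>i\<close>, \<open>ln B\<^sub>j\<close> are absorbed
    by the hypothesis that bounds the product by \<open>\<theta>\<close>.

  Both monotonicity claims say that a derivative has a sign, and they amount to the single
  inequality \<open>z \<bar>\<psi>\<^sup>(\<^sup>n\<^sup>+\<^sup>1\<^sup>)(z + a)\<bar> \<le> n \<bar>\<psi>\<^sup>(\<^sup>n\<^sup>)(z + a)\<bar>\<close>, with \<open>1\<close> as the right-hand side if \<open>n = 0\<close>
  (\<open>abs_Polygamma_Suc_le\<close>). With \<open>m = n + 1\<close> and \<open>y\<^sub>k = w + k\<close>, the series for the polygamma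
  functions turn it into the inequality
  \[ \sum_k y_k^{-m} \le \sum_k m (k + 1/2) y_k^{-m-1}, \]
  for partial sums, up to a boundary term. This follows by weighting the trapezoidal rule for the convex function
  \<open>m t\<^sup>-\<^sup>m\<^sup>-\<^sup>1\<close> on the intervals \<open>[y\<^sub>k, y\<^sub>k\<^sub>+\<^sub>1]\<close> with \<open>k + 1\<close> and summing by parts; the half in
  \<open>k + 1/2\<close> is where the condition \<open>a \<ge> 1/2\<close> comes from.
\<close>

section \<open>A trapezoidal estimate for sums of negative powers\<close>

lemma Chebyshev_two_powers:
  fixes p q :: "'a :: linordered_idom"
  assumes "0 \<le> p" "0 \<le> q"
  shows "p ^ i * q ^ j + q ^ i * p ^ j \<le> p ^ (i + j) + q ^ (i + j)"
proof -
  have "0 \<le> (p ^ i - q ^ i) * (p ^ j - q ^ j)"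
    using assms by (cases rule: linorder_le_cases[of p q]) (simp_all add: zero_le_mult_iff power_mono)
  thus ?thesis by (simp add: algebra_simps power_add)
qed

text \<open>
  For \<open>p = 1 / y\<close> and \<open>q = 1 / (y + 1)\<close>, which satisfy \<open>p - q = p q\<close>, this is the trapezoidal
  upper bound for the integral of the convex function \<open>m t\<^sup>-\<^sup>m\<^sup>-\<^sup>1\<close> over \<open>[y, y + 1]\<close>. The algebraic
  form has an induction over \<open>m\<close> that avoids the integral.
\<close>

lemma trapezoid_inverse_powers:
  fixes p q :: real
  assumes "0 \<le> p" "0 \<le> q" "p - q = p * q"
  shows "p ^ m - q ^ m \<le> real m / 2 * (p ^ Suc m + q ^ Suc m)"
proof (induction m)
  case 0
  show ?case by simp
next
  case (Suc m)
  have 1: "(p + q) * (p ^ Suc m + q ^ Suc m) \<le> 2 * (p ^ Suc (Suc m) + q ^ Suc (Suc m))"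
    using Chebyshev_two_powers[OF assms(1,2), of 1 "Suc m"] by (simp add: algebra_simps)
  have 2: "p * q * (p ^ m + q ^ m) \<le> p ^ Suc (Suc m) + q ^ Suc (Suc m)"
    using Chebyshev_two_powers[OF assms(1,2), of 1 "Suc m"] by (simp add: algebra_simps)
  have "2 * (p ^ Suc m - q ^ Suc m) = (p + q) * (p ^ m - q ^ m) + (p - q) * (p ^ m + q ^ m)"
    by (simp add: algebra_simps)
  also have "\<dots> = (p + q) * (p ^ m - q ^ m) + p * q * (p ^ m + q ^ m)"
    by (simp only: assms(3))
  also have "\<dots> \<le> (p + q) * (real m / 2 * (p ^ Suc m + q ^ Suc m)) + p * q * (p ^ m + q ^ m)"
    using assms by (intro add_right_mono mult_left_mono Suc.IH) auto
  also have "\<dots> = real m / 2 * ((p + q) * (p ^ Suc m + q ^ Suc m)) + p * q * (p ^ m + q ^ m)"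
    by (simp only: mult_ac)
  also have "\<dots> \<le> real m / 2 * (2 * (p ^ Suc (Suc m) + q ^ Suc (Suc m)))
                  + (p ^ Suc (Suc m) + q ^ Suc (Suc m))"
    by (intro add_mono mult_left_mono 1 2) auto
  also have "\<dots> = 2 * (real (Suc m) / 2 * (p ^ Suc (Suc m) + q ^ Suc (Suc m)))"
    by (simp add: field_simps)
  finally show ?case by (simp del: power_Suc of_nat_Suc)
qed

text \<open>
  This is the \<open>k\<close>-th trapezoidal estimate times \<open>k + 1\<close>, summed by parts over \<open>k < N\<close>; the
  last summand is the boundary term.
\<close>

lemma sum_inverse_powers_le:
  fixes w :: real
  assumes "w > 0"
  defines "u \<equiv> \<lambda>k::nat. inverse (w + real k)"
  shows "(\<Sum>k<N. u k ^ m) \<le> (\<Sum>k<N. real m * (real k + 1 / 2) * u k ^ Suc m)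
           + real N * (real m / 2 * u N ^ Suc m + u N ^ m)"
proof (induction N)
  case 0
  show ?case by simp
next
  case (Suc N)
  have "u N ^ m - u (Suc N) ^ m \<le> real m / 2 * (u N ^ Suc m + u (Suc N) ^ Suc m)"
    using assms by (intro trapezoid_inverse_powers) (auto simp: u_def field_simps)
  hence "real (Suc N) * (u N ^ m - u (Suc N) ^ m)
           \<le> real (Suc N) * (real m / 2 * (u N ^ Suc m + u (Suc N) ^ Suc m))"
    by (intro mult_left_mono) auto
  hence "u N ^ m + real N * (real m / 2 * u N ^ Suc m + u N ^ m)
     \<le> real m * (real N + 1 / 2) * u N ^ Suc m
       + real (Suc N) * (real m / 2 * u (Suc N) ^ Suc m + u (Suc N) ^ m)"
    by (simp add: field_simps)
  with Suc.IH show ?case by (simp del: power_Suc of_nat_Suc)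
qed

section \<open>Monotonicity properties of polygamma functions\<close>

lemma pos_not_nonpos_Ints: "(x::real) > 0 \<Longrightarrow> x \<notin> \<int>\<^sub>\<le>\<^sub>0"
  by (auto elim!: nonpos_Ints_cases)

text \<open>
  For \<open>n \<ge> 1\<close> this is the absolute value of the polygamma function; the sign is kept explicit
  so that derivatives stay uniform in \<open>n\<close>.
\<close>

definition abs_Polygamma :: "nat \<Rightarrow> real \<Rightarrow> real" where
  "abs_Polygamma n z = (-1) ^ Suc n * Polygamma n z"

lemma abs_Polygamma_sums:
  assumes "z > 0" "n > 0"
  shows "(\<lambda>k. inverse (z + real k) ^ Suc n) sums (abs_Polygamma n z / fact n)"
  using Polygamma_LIMSEQ[of z n] assms by (simp add: abs_Polygamma_def power_inverse)

lemma DERIV_abs_Polygamma: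
  assumes "z > 0"
  shows "(abs_Polygamma n has_real_derivative - abs_Polygamma (Suc n) z) (at z)"
  unfolding abs_Polygamma_def [abs_def]
  by (auto intro!: derivative_eq_intros simp: pos_not_nonpos_Ints assms)

text \<open>
  The summand \<open>0 ^ n\<close> equals \<open>1\<close> for \<open>n = 0\<close> and vanishes otherwise. It is the limit of the
  boundary term in \<open>sum_inverse_powers_le\<close>.
\<close>

lemma abs_Polygamma_Suc_le:
  assumes "z > 0" "a \<ge> 1 / 2"
  shows "z * abs_Polygamma (Suc n) (z + a) \<le> real n * abs_Polygamma n (z + a) + 0 ^ n"
proof -
  define w where "w = z + a"
  have w: "w > 0" using assms by (simp add: w_def)
  define u where "u = (\<lambda>k::nat. inverse (w + real k))"
  define R where "R = (\<lambda>N. real N * (real (Suc n) / 2 * u N ^ Suc (Suc n) + u N ^ Suc n))"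
  have u_pos: "u k > 0" for k using w by (simp add: u_def)
  have finite_bound: "real (Suc n) * z * (\<Sum>k<N. u k ^ Suc (Suc n))
                        \<le> real n * (\<Sum>k<N. u k ^ Suc n) + R N" for N
  proof -
    have "(\<Sum>k<N. real (Suc n) * (real k + 1 / 2) * u k ^ Suc (Suc n))
            \<le> (\<Sum>k<N. real (Suc n) * u k ^ Suc n - real (Suc n) * z * u k ^ Suc (Suc n))"
    proof (rule sum_mono)
      fix k
      have "real k + 1 / 2 \<le> (w + real k) - z"
        using assms by (simp add: w_def)
      hence "real (Suc n) * u k ^ Suc (Suc n) * (real k + 1 / 2)
               \<le> real (Suc n) * u k ^ Suc (Suc n) * ((w + real k) - z)"
        using u_pos[of k] by (intro mult_left_mono mult_nonneg_nonneg) auto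
      moreover have "real (Suc n) * u k ^ Suc (Suc n) * (w + real k) = real (Suc n) * u k ^ Suc n"
        using w by (simp add: u_def)
      ultimately show "real (Suc n) * (real k + 1 / 2) * u k ^ Suc (Suc n)
            \<le> real (Suc n) * u k ^ Suc n - real (Suc n) * z * u k ^ Suc (Suc n)"
        by (simp add: algebra_simps del: power_Suc of_nat_Suc)
    qed
    with sum_inverse_powers_le[OF w, of "Suc n" N] show ?thesis
      by (simp add: sum_subtractf sum_distrib_left [symmetric] R_def u_def mult.assoc
               del: power_Suc) (simp add: algebra_simps)
  qed
  have u_lim: "u \<longlonglongrightarrow> 0"
    unfolding u_def by real_asymp
  have Nu_lim: "(\<lambda>N. real N * u N) \<longlonglongrightarrow> 1"
    unfolding u_def by real_asymp
  have "(\<lambda>N. (real N * u N) * (real (Suc n) / 2 * u N ^ Suc n + u N ^ n))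
          \<longlonglongrightarrow> 1 * (real (Suc n) / 2 * 0 ^ Suc n + 0 ^ n)"
    by (intro tendsto_intros u_lim Nu_lim)
  hence R_lim: "R \<longlonglongrightarrow> 0 ^ n"
    by (simp add: R_def [abs_def] algebra_simps)
  have upper: "(\<lambda>N. real (Suc n) * z * (\<Sum>k<N. u k ^ Suc (Suc n)))
          \<longlonglongrightarrow> real (Suc n) * z * (abs_Polygamma (Suc n) w / fact (Suc n))"
    using abs_Polygamma_sums[OF w, of "Suc n"]
    unfolding sums_def u_def by (intro tendsto_mult_left) auto
  \<comment> \<open>for \<open>n = 0\<close> the sums diverge, but they are multiplied by zero\<close>
  have lower: "(\<lambda>N. real n * (\<Sum>k<N. u k ^ Suc n)) \<longlonglongrightarrow> real n * (abs_Polygamma n w / fact n)"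
  proof (cases "n = 0")
    case False
    thus ?thesis
      using abs_Polygamma_sums[OF w, of n]
      unfolding sums_def u_def by (intro tendsto_mult_left) auto
  qed simp
  have "real (Suc n) * z * (abs_Polygamma (Suc n) w / fact (Suc n))
          \<le> real n * (abs_Polygamma n w / fact n) + 0 ^ n"
    by (rule LIMSEQ_le[OF upper tendsto_add[OF lower R_lim]]) (use finite_bound in blast)
  hence "fact n * (real (Suc n) * z * (abs_Polygamma (Suc n) w / fact (Suc n)))
          \<le> fact n * (real n * (abs_Polygamma n w / fact n) + 0 ^ n)"
    by (intro mult_left_mono) auto
  also have "fact n * (real (Suc n) * z * (abs_Polygamma (Suc n) w / fact (Suc n)))
               = z * abs_Polygamma (Suc n) w"
    by (simp add: fact_Suc del: of_nat_Suc)
  also have "fact n * (real n * (abs_Polygamma n w / fact n) + 0 ^ n)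
               = real n * abs_Polygamma n w + 0 ^ n"
    by (cases "n = 0") (simp_all add: field_simps)
  finally show ?thesis by (simp add: w_def)
qed

lemma mono_on_power_times_abs_Polygamma:
  assumes "a \<ge> 1 / 2" "n > 0"
  shows "mono_on {0<..} (\<lambda>z. z ^ n * abs_Polygamma n (z + a))"
proof (rule mono_onI)
  fix y z :: real
  assume "y \<in> {0<..}" "z \<in> {0<..}" and "y \<le> z"
  hence y: "0 < y" by simp
  show "y ^ n * abs_Polygamma n (y + a) \<le> z ^ n * abs_Polygamma n (z + a)"
  proof (rule DERIV_nonneg_imp_nondecreasing[OF \<open>y \<le> z\<close>])
    fix t assume t: "y \<le> t" "t \<le> z"
    from t y have "t > 0" by simp
    obtain m where n: "n = Suc m" using \<open>n > 0\<close> by (cases n) auto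
    have "((\<lambda>z. z ^ n * abs_Polygamma n (z + a)) has_real_derivative
            t ^ m * (real n * abs_Polygamma n (t + a) - t * abs_Polygamma (Suc n) (t + a))) (at t)"
      using \<open>t > 0\<close> assms
      by (intro DERIV_cong[OF DERIV_mult[OF DERIV_pow
                  DERIV_chain2[OF DERIV_abs_Polygamma DERIV_add[OF DERIV_ident DERIV_const]]]])
         (simp_all add: n algebra_simps)
    moreover have "t * abs_Polygamma (Suc n) (t + a) \<le> real n * abs_Polygamma n (t + a)"
      using abs_Polygamma_Suc_le[OF \<open>t > 0\<close> assms(1), of n] \<open>n > 0\<close> by (simp add: zero_power)
    ultimately show "\<exists>d. ((\<lambda>z. z ^ n * abs_Polygamma n (z + a)) has_real_derivative d) (at t) \<and> 0 \<le> d"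
      using \<open>t > 0\<close> by (intro exI conjI) auto
  qed
qed

lemma mono_on_ln_minus_Digamma:
  assumes "a \<ge> 1 / 2"
  shows "mono_on {0<..} (\<lambda>z::real. ln z - Digamma (z + a))"
proof (rule mono_onI)
  fix y z :: real
  assume "y \<in> {0<..}" "z \<in> {0<..}" and "y \<le> z"
  hence y: "0 < y" by simp
  show "ln y - Digamma (y + a) \<le> ln z - Digamma (z + a)"
  proof (rule DERIV_nonneg_imp_nondecreasing[OF \<open>y \<le> z\<close>])
    fix t assume t: "y \<le> t" "t \<le> z"
    from t y have "t > 0" by simp
    have "((\<lambda>z. ln z - Digamma (z + a)) has_real_derivative
            1 / t - Polygamma 1 (t + a)) (at t)"
      using \<open>t > 0\<close> assms
      by (auto intro!: derivative_eq_intros simp: pos_not_nonpos_Ints)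
    moreover have "t * Polygamma 1 (t + a) \<le> 1"
      using abs_Polygamma_Suc_le[OF \<open>t > 0\<close> assms(1), of 0] by (simp add: abs_Polygamma_def)
    ultimately show "\<exists>d. ((\<lambda>z. ln z - Digamma (z + a)) has_real_derivative d) (at t) \<and> 0 \<le> d"
      using \<open>t > 0\<close> by (intro exI conjI) (auto simp: field_simps)
  qed
qed

section \<open>Comparison of weighted sums\<close>

text \<open>
  Multiplying the claim by the common total weight turns the difference of the two sides into
  the double sum of \<open>w\<^sub>i v\<^sub>j (f\<^sub>i - g\<^sub>j)\<close>, in which every term is nonnegative.
\<close>

lemma weighted_sum_le_of_separated:
  fixes w f :: "'i \<Rightarrow> real" and v g :: "'j \<Rightarrow> real"
  assumes "finite I" "finite J"
    and w: "\<And>i. i \<in> I \<Longrightarrow> 0 \<le> w i" and v: "\<And>j. j \<in> J \<Longrightarrow> 0 \<le> v j"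
    and total: "sum w I = sum v J"
    and le: "\<And>i j. i \<in> I \<Longrightarrow> j \<in> J \<Longrightarrow> g j \<le> f i"
  shows "(\<Sum>j\<in>J. v j * g j) \<le> (\<Sum>i\<in>I. w i * f i)"
proof (cases "sum w I = 0")
  case True
  hence "\<forall>i\<in>I. w i = 0" "\<forall>j\<in>J. v j = 0"
    using assms by (simp_all add: sum_nonneg_eq_0_iff)
  thus ?thesis by simp
next
  case False
  hence pos: "sum w I > 0" using w by (simp add: sum_nonneg order.strict_iff_order)
  have "sum w I * (\<Sum>j\<in>J. v j * g j) = (\<Sum>i\<in>I. \<Sum>j\<in>J. w i * v j * g j)"
    by (simp add: sum_product mult.assoc)
  also have "\<dots> \<le> (\<Sum>i\<in>I. \<Sum>j\<in>J. w i * v j * f i)"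
    by (intro sum_mono mult_left_mono le mult_nonneg_nonneg w v)
  also have "\<dots> = (\<Sum>i\<in>I. w i * f i) * sum v J"
    unfolding sum_product by (simp add: mult_ac)
  finally show ?thesis using pos total by (simp add: mult.commute)
qed

section \<open>Complete monotonicity of the logarithmic derivative\<close>

text \<open>
  The iterated derivatives are known only on the positive half-line, so the induction compares
  them near a point rather than as functions.
\<close>

lemma higher_deriv_eq_on_pos:
  fixes f :: "real \<Rightarrow> real" and F :: "nat \<Rightarrow> real \<Rightarrow> real"
  assumes "\<And>x. x > 0 \<Longrightarrow> f x = F 0 x"
    and "\<And>n x. x > 0 \<Longrightarrow> (F n has_real_derivative F (Suc n) x) (at x)"
    and "x > 0"
  shows "(deriv ^^ n) f x = F n x" "((deriv ^^ n) f has_real_derivative F (Suc n) x) (at x)"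
proof -
  have step: "(g has_real_derivative F (Suc n) x) (at x)"
    if "\<And>y. y > 0 \<Longrightarrow> g y = F n y" "x > 0" for g n x
  proof (rule DERIV_cong_ev[THEN iffD2, OF refl _ refl assms(2)])
    show "\<forall>\<^sub>F y in nhds x. g y = F n y"
      using eventually_nhds_in_open[of "{0<..}" x] that
      by (auto elim!: eventually_mono)
  qed (use that in auto)
  have eq: "\<And>x. x > 0 \<Longrightarrow> (deriv ^^ n) f x = F n x" for n
  proof (induction n)
    case (Suc n)
    thus ?case using step[of "(deriv ^^ n) f" n] by (auto intro: DERIV_imp_deriv)
  qed (use assms(1) in auto)
  show "(deriv ^^ n) f x = F n x" "((deriv ^^ n) f has_real_derivative F (Suc n) x) (at x)"
    using eq step[of "(deriv ^^ n) f" n] \<open>x > 0\<close> by auto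
qed

lemma completely_monotonicI:
  fixes f :: "real \<Rightarrow> real" and F :: "nat \<Rightarrow> real \<Rightarrow> real"
  assumes "\<And>x. x > 0 \<Longrightarrow> f x = F 0 x"
    and "\<And>n x. x > 0 \<Longrightarrow> (F n has_real_derivative F (Suc n) x) (at x)"
    and "\<And>n x. x > 0 \<Longrightarrow> 0 \<le> (-1) ^ n * F n x"
  shows "completely_monotonic f"
  unfolding completely_monotonic_def
  using higher_deriv_eq_on_pos[OF assms(1,2)] assms(1) assms(3) assms(3)[of _ 0]
  by (fastforce simp: real_differentiable_def)

lemma
  fixes f \<gamma> :: "'k \<Rightarrow> real"
  assumes "\<And>k. k \<in> K \<Longrightarrow> f k > 0"
  shows prod_powr_pos: "(\<Prod>k\<in>K. f k powr \<gamma> k) > 0"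
    and ln_prod_powr: "finite K \<Longrightarrow> ln (\<Prod>k\<in>K. f k powr \<gamma> k) = (\<Sum>k\<in>K. \<gamma> k * ln (f k))"
proof -
  have pos: "f k powr \<gamma> k > 0" if "k \<in> K" for k using assms[OF that] by simp
  show "(\<Prod>k\<in>K. f k powr \<gamma> k) > 0" by (intro prod_pos pos)
  assume "finite K"
  hence "ln (\<Prod>k\<in>K. f k powr \<gamma> k) = (\<Sum>k\<in>K. ln (f k powr \<gamma> k))"
    by (intro ln_prod less_imp_neq[THEN not_sym] pos)
  also have "\<dots> = (\<Sum>k\<in>K. \<gamma> k * ln (f k))"
    by (intro sum.cong refl ln_powr)
  finally show "ln (\<Prod>k\<in>K. f k powr \<gamma> k) = (\<Sum>k\<in>K. \<gamma> k * ln (f k))" .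
qed

theorem theorem3p12:
  fixes \<theta> a :: real
    and p s :: nat
    and A \<alpha> B \<beta> :: "nat \<Rightarrow> real"
  assumes "\<theta> > 0"
    and "\<forall>i\<in>{1..p}. A i > 0 \<and> \<alpha> i > 0"
    and "\<forall>j\<in>{1..s}. B j > 0 \<and> \<beta> j > 0"
    and "(\<Sum>i=1..p. \<alpha> i * A i) = (\<Sum>j=1..s. \<beta> j * B j)"
    and "(\<Prod>i=1..p. A i powr (\<alpha> i * A i)) * (\<Prod>j=1..s. B j powr (- (\<beta> j * B j))) \<le> \<theta>"
    and "a \<ge> 1 / 2"
    and "antimono_on {1..p} A"
    and "\<forall>i\<in>{1..p}. \<forall>j\<in>{1..s}. A i \<ge> B j"
    and "antimono_on {1..s} B"
    and "antimono_on {1..p} (\<lambda>i. \<alpha> i * A i)"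
    and "mono_on {1..s} (\<lambda>j. \<beta> j * B j)"
  shows "log_completely_monotonic
    (\<lambda>x. \<theta> powr (- x) * ((\<Prod>i=1..p. Gamma (A i * x + a) powr \<alpha> i) /
                         (\<Prod>j=1..s. Gamma (B j * x + a) powr \<beta> j)))"
proof -
  define I where "I = {1..p}"
  define J where "J = {1..s}"
  have fin: "finite I" "finite J" by (simp_all add: I_def J_def)
  have A: "A i > 0" "\<alpha> i > 0" if "i \<in> I" for i using assms(2) that by (auto simp: I_def)
  have B: "B j > 0" "\<beta> j > 0" if "j \<in> J" for j using assms(3) that by (auto simp: J_def)
  have AB: "B j \<le> A i" if "i \<in> I" "j \<in> J" for i j using assms(8) that by (auto simp: I_def J_def)
  have weights: "(\<Sum>i\<in>I. \<alpha> i * A i) = (\<Sum>j\<in>J. \<beta> j * B j)" using assms(4) by (simp add: I_def J_def)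
  have compare: "(\<Sum>j\<in>J. \<beta> j * B j * g (B j)) \<le> (\<Sum>i\<in>I. \<alpha> i * A i * g (A i))"
    if "mono_on {0<..} g" for g
    using fin weights A B AB that
    by (intro weighted_sum_le_of_separated) (auto intro: mono_onD less_imp_le mult_pos_pos)

  define V where "V = (\<lambda>x. \<theta> powr (- x) * ((\<Prod>i\<in>I. Gamma (A i * x + a) powr \<alpha> i) /
                         (\<Prod>j\<in>J. Gamma (B j * x + a) powr \<beta> j)))"
  \<comment> \<open>\<open>F n\<close> is the \<open>n\<close>-th derivative of \<open>- (ln V)'\<close> on the positive half-line\<close>
  define F where "F = (\<lambda>n x. (if n = 0 then ln \<theta> else 0)
     - (\<Sum>i\<in>I. \<alpha> i * A i * (A i ^ n * Polygamma n (A i * x + a)))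
     + (\<Sum>j\<in>J. \<beta> j * B j * (B j ^ n * Polygamma n (B j * x + a))))"
  have arg_pos: "c * x + a > 0" if "c > 0" "x > 0" for c x
    using that assms(6) by (intro add_pos_pos mult_pos_pos) auto
  have Gamma_pos: "Gamma (c * x + a) > 0" if "c > 0" "x > 0" for c x
    using arg_pos[OF that] by (rule Gamma_real_pos)
  have V_pos: "V x > 0" if "x > 0" for x
    unfolding V_def using assms(1) that
    by (intro mult_pos_pos divide_pos_pos prod_powr_pos Gamma_pos A B) auto
  have ln_V: "ln (V x) = - x * ln \<theta> + (\<Sum>i\<in>I. \<alpha> i * ln_Gamma (A i * x + a))
                 - (\<Sum>j\<in>J. \<beta> j * ln_Gamma (B j * x + a))" if "x > 0" for x
  proof -
    have num: "(\<Prod>i\<in>I. Gamma (A i * x + a) powr \<alpha> i) > 0"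
      and den: "(\<Prod>j\<in>J. Gamma (B j * x + a) powr \<beta> j) > 0"
      using that by (intro prod_powr_pos Gamma_pos A B; simp)+
    have "ln (V x) = ln (\<theta> powr (- x)) + (ln (\<Prod>i\<in>I. Gamma (A i * x + a) powr \<alpha> i)
                       - ln (\<Prod>j\<in>J. Gamma (B j * x + a) powr \<beta> j))"
      using num den assms(1) by (simp add: V_def ln_mult_pos ln_divide_pos)
    also have "ln (\<Prod>i\<in>I. Gamma (A i * x + a) powr \<alpha> i) = (\<Sum>i\<in>I. \<alpha> i * ln (Gamma (A i * x + a)))"
      using that fin by (intro ln_prod_powr Gamma_pos A)
    also have "ln (\<Prod>j\<in>J. Gamma (B j * x + a) powr \<beta> j) = (\<Sum>j\<in>J. \<beta> j * ln (Gamma (B j * x + a)))"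
      using that fin by (intro ln_prod_powr Gamma_pos B)
    finally show ?thesis
      using that assms(1) A(1) B(1) by (simp add: ln_powr ln_Gamma_real_pos arg_pos)
  qed

  have V_deriv: "((\<lambda>y. ln (V y)) has_real_derivative - F 0 x) (at x)" if "x > 0" for x
  proof (rule DERIV_cong_ev[THEN iffD2, OF refl _ refl])
    show "\<forall>\<^sub>F y in nhds x. ln (V y) = - y * ln \<theta> + (\<Sum>i\<in>I. \<alpha> i * ln_Gamma (A i * y + a))
                 - (\<Sum>j\<in>J. \<beta> j * ln_Gamma (B j * y + a))"
      using eventually_nhds_in_open[of "{0<..}" x] that ln_V by (auto elim!: eventually_mono)
    show "((\<lambda>y. - y * ln \<theta> + (\<Sum>i\<in>I. \<alpha> i * ln_Gamma (A i * y + a))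
                 - (\<Sum>j\<in>J. \<beta> j * ln_Gamma (B j * y + a))) has_real_derivative - F 0 x) (at x)"
      using that arg_pos A B
      by (auto intro!: derivative_eq_intros sum.cong simp: F_def mult_ac)
  qed

  have F_deriv: "(F n has_real_derivative F (Suc n) x) (at x)" if "x > 0" for n x
    unfolding F_def using that arg_pos A B
    by (auto intro!: derivative_eq_intros sum.cong simp: pos_not_nonpos_Ints mult_ac)

  have F_0_nonneg: "0 \<le> F 0 x" if "x > 0" for x
  proof -
    have "mono_on {0<..} (\<lambda>c. ln (c * x) - Digamma (c * x + a))"
      using mono_on_ln_minus_Digamma[OF assms(6)] that
      by (auto simp: monotone_on_def)
    from compare[OF this]
    have "(\<Sum>j\<in>J. \<beta> j * B j * (ln (B j) + ln x - Digamma (B j * x + a)))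
            \<le> (\<Sum>i\<in>I. \<alpha> i * A i * (ln (A i) + ln x - Digamma (A i * x + a)))"
      using A B that by (simp add: ln_mult_pos cong: sum.cong)
    hence "(\<Sum>j\<in>J. \<beta> j * B j * ln (B j)) - (\<Sum>j\<in>J. \<beta> j * B j * Digamma (B j * x + a))
            \<le> (\<Sum>i\<in>I. \<alpha> i * A i * ln (A i)) - (\<Sum>i\<in>I. \<alpha> i * A i * Digamma (A i * x + a))"
      using weights
      by (simp add: ring_distribs sum.distrib sum_subtractf sum_distrib_right [symmetric])
    moreover have "(\<Sum>i\<in>I. \<alpha> i * A i * ln (A i)) - (\<Sum>j\<in>J. \<beta> j * B j * ln (B j)) \<le> ln \<theta>"
    proof -
      have pos: "(\<Prod>i\<in>I. A i powr (\<alpha> i * A i)) > 0" "(\<Prod>j\<in>J. B j powr (- (\<beta> j * B j))) > 0"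
        using A B by (intro prod_powr_pos; simp)+
      have "ln ((\<Prod>i\<in>I. A i powr (\<alpha> i * A i)) * (\<Prod>j\<in>J. B j powr (- (\<beta> j * B j)))) \<le> ln \<theta>"
        using assms(5) pos by (intro ln_mono mult_pos_pos) (simp_all add: I_def J_def)
      also have "ln ((\<Prod>i\<in>I. A i powr (\<alpha> i * A i)) * (\<Prod>j\<in>J. B j powr (- (\<beta> j * B j))))
           = ln (\<Prod>i\<in>I. A i powr (\<alpha> i * A i)) + ln (\<Prod>j\<in>J. B j powr (- (\<beta> j * B j)))"
        using pos by (rule ln_mult_pos)
      also have "\<dots> = (\<Sum>i\<in>I. \<alpha> i * A i * ln (A i)) + (\<Sum>j\<in>J. - (\<beta> j * B j) * ln (B j))"
        using A B fin by (simp add: ln_prod_powr)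
      finally show ?thesis by (simp add: sum_negf)
    qed
    ultimately show ?thesis by (simp add: F_def)
  qed

  have F_sign: "0 \<le> (-1) ^ n * F n x" if "x > 0" for n x
  proof (cases "n = 0")
    case False
    define g where "g = (\<lambda>c. c ^ n * abs_Polygamma n (c * x + a))"
    have "mono_on {0<..} (\<lambda>c. (c * x) ^ n * abs_Polygamma n (c * x + a))"
      using mono_on_power_times_abs_Polygamma[OF assms(6), of n] that False
      by (auto simp: monotone_on_def)
    hence "mono_on {0<..} g"
      using that by (auto simp: monotone_on_def g_def power_mult_distrib mult_ac)
    from compare[OF this] have "0 \<le> (\<Sum>i\<in>I. \<alpha> i * A i * g (A i)) - (\<Sum>j\<in>J. \<beta> j * B j * g (B j))"
      by simp
    also have "\<dots> = (-1) ^ n * F n x"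
      using False
      by (simp add: F_def g_def abs_Polygamma_def algebra_simps sum_distrib_left sum_negf)
    finally show ?thesis .
  qed (use F_0_nonneg[OF that] in simp)

  have "completely_monotonic (\<lambda>x. - deriv (\<lambda>y. ln (V y)) x)"
    using DERIV_imp_deriv[OF V_deriv] by (intro completely_monotonicI[of _ F] F_deriv F_sign) simp_all
  hence "log_completely_monotonic V"
    using V_pos V_deriv by (auto simp: log_completely_monotonic_def real_differentiable_def)
  thus ?thesis by (simp add: V_def I_def J_def)
qed

end
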